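(* Let $n\ge 19$ be an integer and let $r_n'\in\{0,1,\dots,5\}$ be the residue of $n$ modulo $6$. Then the set $\{u_0,u_1,x,y\}$ is an edge resolving set of the graph $P(n,3)$, where $$\{x,y\}=\begin{cases}\{v_2,\,u_{\lfloor n/2\rfloor-1}\},&\text{if } r_n'\in\{0,1,3\},\\ \{u_{n/2-3},\,v_{n/2-2}\},&\text{if } r_n'=2,\\ \{v_2,\,u_{n/2+3}\},&\text{if } r_n'=4,\\ \{u_{\lfloor n/2\rfloor-1},\,v_{\lfloor n/2\rfloor}\},&\text{if } r_n'=5.\end{cases}$$
   Context: For integers $n\ge 3$ and $1\le k<n/2$, the generalized Petersen graph $P(n,k)$ is the graph with vertex set $\{u_j,v_j : j\in\mathbb{Z}_n\}$ and edge set $\{u_ju_{j+1},\,v_jv_{j+k},\,u_jv_j : j\in\mathbb{Z}_n\}$, indices taken modulo $n$. In a connected graph $G$, the distance between a vertex $x$ and an edge $e=yz$ is $d(x,e)=\min\{d(x,y),d(x,z)\}$, where $d(\cdot,\cdot)$ is the usual graph distance. A set $R$ of vertices is an edge resolving set of $G$ if for every two distinct edges $e,e'$ of $G$ there is $x\in R$ with $d(x,e)\ne d(x,e')$. *)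

theory Defs
  imports Main
begin

record 'a ugraph =
  verts :: "'a set"
  edges :: "'a set set"

definition simple_graph :: "('a, 'b) ugraph_scheme \<Rightarrow> bool" where
  "simple_graph G \<longleftrightarrow> finite (verts G) \<and> (\<forall>e\<in>edges G. e \<subseteq> verts G \<and> card e = 2)"

definition adj :: "('a, 'b) ugraph_scheme \<Rightarrow> ('a \<times> 'a) set" where
  "adj G = {(x, y). {x, y} \<in> edges G}"

definition connected_graph :: "('a, 'b) ugraph_scheme \<Rightarrow> bool" where
  "connected_graph G \<longleftrightarrow> (\<forall>x\<in>verts G. \<forall>y\<in>verts G. (x, y) \<in> (adj G)\<^sup>*)"

text \<open>
  \<open>(x, y) \<in> adj G ^^ m\<close> says that there is a walk of length \<open>m\<close> from \<open>x\<close> to \<open>y\<close>.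
  The value is meaningful only if some walk exists, so for all pairs of vertices
  of a connected graph.
\<close>
definition gdist :: "('a, 'b) ugraph_scheme \<Rightarrow> 'a \<Rightarrow> 'a \<Rightarrow> nat" where
  "gdist G x y = (LEAST m. (x, y) \<in> adj G ^^ m)"

definition edge_dist :: "('a, 'b) ugraph_scheme \<Rightarrow> 'a \<Rightarrow> 'a set \<Rightarrow> nat" where
  "edge_dist G x e = Min (gdist G x ` e)"

definition edge_resolving_set :: "('a, 'b) ugraph_scheme \<Rightarrow> 'a set \<Rightarrow> bool" where
  "edge_resolving_set G R \<longleftrightarrow> R \<subseteq> verts G \<and>
     (\<forall>e\<in>edges G. \<forall>e'\<in>edges G. e \<noteq> e' \<longrightarrow> (\<exists>x\<in>R. edge_dist G x e \<noteq> edge_dist G x e'))"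

text \<open>
  The elements of \<open>\<int>\<^sub>n\<close> are represented by \<open>0, \<dots>, n - 1\<close>; a term \<open>U j\<close> or \<open>V j\<close> with
  \<open>j \<ge> n\<close> is not a vertex of the graph.
\<close>
datatype pvertex = U nat | V nat

definition gen_petersen :: "nat \<Rightarrow> nat \<Rightarrow> pvertex ugraph" where
  "gen_petersen n k =
     \<lparr> verts = U ` {..<n} \<union> V ` {..<n},
       edges = (\<Union>j<n. {{U j, U ((j + 1) mod n)}, {V j, V ((j + k) mod n)}, {U j, V j}}) \<rparr>"

lemma sym_adj: "sym (adj G)"
  by (auto simp: sym_def adj_def insert_commute)

lemma edge_dist_pair: "edge_dist G x {y, z} = min (gdist G x y) (gdist G x z)"
  by (simp add: edge_dist_def)

lemma simple_gen_petersen: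
  assumes "n \<ge> 3" "1 \<le> k" "2 * k < n"
  shows "simple_graph (gen_petersen n k)"
proof -
  have "j \<noteq> (j + d) mod n" if "j < n" "1 \<le> d" "d < n" for j d
    using that by (cases "j + d < n") (auto simp: mod_if)
  from this[of _ 1] this[of _ k] show ?thesis
    using assms by (auto simp: simple_graph_def gen_petersen_def card_2_iff)
qed

lemma connected_gen_petersen: "connected_graph (gen_petersen n k)"
proof -
  let ?R = "adj (gen_petersen n k)"
  have U0: "(U 0, U j) \<in> ?R\<^sup>*" if "j < n" for j
    using that
  proof (induction j)
    case 0
    show ?case by simp
  next
    case (Suc j)
    have "{U j, U (Suc j)} = {U j, U ((j + 1) mod n)}"
      using Suc.prems by simp
    then have "(U j, U (Suc j)) \<in> ?R"
      using Suc.prems unfolding adj_def gen_petersen_def by fastforce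
    then show ?case
      using Suc by (simp add: rtrancl.rtrancl_into_rtrancl)
  qed
  have "(U j, V j) \<in> ?R" if "j < n" for j
    using that by (auto simp: adj_def gen_petersen_def)
  then have reach: "(U 0, x) \<in> ?R\<^sup>*" if "x \<in> verts (gen_petersen n k)" for x
    using that U0 by (auto simp: gen_petersen_def intro: rtrancl.rtrancl_into_rtrancl)
  show ?thesis
    unfolding connected_graph_def
    by (meson reach rtrancl_trans sym_adj sym_rtrancl symD)
qed

end

theory Submission
  imports Defs "HOL-Library.Code_Binary_Nat"
begin

text \<open>
  Lifting walks to the infinite strip that covers \<open>P(n, 3)\<close> shows that the distance of two vertices of
  given kinds is the smaller of the values of one function at the two lengths of the arc between
  their columns, and this function grows by \<open>1\<close> when a length of at least \<open>3\<close> grows by \<open>3\<close>.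

  Call the circular distance of a column from column \<open>0\<close> its height. Deleting three consecutive columns
  at the same height on both sides turns \<open>P(n, 3)\<close> into \<open>P(n - 6, 3)\<close>, and for edges that lie all below
  or all above the deleted columns it changes the distances from a given landmark by a common constant.
  For \<open>n \<ge> 48\<close> two edges at the same distance from \<open>U 0\<close> lie both at height at most \<open>n div 2 - 9\<close> or both
  at height at least \<open>10\<close>, so if they were undistinguished, then their images in \<open>P(n - 6, 3)\<close> would be
  undistinguished too. This leaves \<open>19 \<le> n < 48\<close>, where the edge codes are computed.
\<close>

section \<open>Distances in P(n, 3)\<close>

text \<open>
  Distances between two vertices whose columns differ by \<open>m\<close> in the infinite graph that has \<open>\<int>\<close> in
  place of \<open>\<int>\<^sub>n\<close>.
\<close>

definition dUU :: "nat \<Rightarrow> nat" where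
  "dUU m = (if m \<le> 2 then m else m div 3 + m mod 3 + 2)"

text \<open>One spoke, \<open>m div 3\<close> inner edges and \<open>m mod 3\<close> outer edges.
  For remainder 2, overshooting by an inner edge and returning along an outer edge costs the
  same.\<close>

definition dUV :: "nat \<Rightarrow> nat" where
  "dUV m = m div 3 + m mod 3 + 1"

text \<open>A nonzero remainder forces outer edges and thereby two spokes; a multiple of 3 is
  covered by inner edges alone.\<close>

definition dVV :: "nat \<Rightarrow> nat" where
  "dVV m = (if m mod 3 = 0 then m div 3 else m div 3 + m mod 3 + 2)"

lemmas offset_dist_defs = dUU_def dUV_def dVV_def

definition arc :: "nat \<Rightarrow> nat \<Rightarrow> nat" where
  "arc i j = (if i \<le> j then j - i else i - j)"

text \<open>Lifts that wind further around the cycle are left out;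
  \<open>gdist_gen_petersen_3\<close> confirms that they never give a shorter walk.\<close>

definition cyc :: "(nat \<Rightarrow> nat) \<Rightarrow> nat \<Rightarrow> nat \<Rightarrow> nat \<Rightarrow> nat" where
  "cyc f n i j = min (f (arc i j)) (f (n - arc i j))"

fun pdist :: "nat \<Rightarrow> pvertex \<Rightarrow> pvertex \<Rightarrow> nat" where
  "pdist n (U i) (U j) = cyc dUU n i j"
| "pdist n (U i) (V j) = cyc dUV n i j"
| "pdist n (V i) (U j) = cyc dUV n i j"
| "pdist n (V i) (V j) = cyc dVV n i j"

text \<open>A potential that vanishes at the source and grows by at most 1 along an edge bounds
  every walk from below; descending it step by step yields a walk that attains the bound.\<close>

lemma gdist_eqI:
  assumes "s \<in> verts G" "x \<in> verts G" "\<phi> s = 0"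
    and lip: "\<And>x y. (x, y) \<in> adj G \<Longrightarrow> \<phi> y \<le> \<phi> x + 1"
    and down: "\<And>x. x \<in> verts G \<Longrightarrow> x \<noteq> s \<Longrightarrow> \<exists>y\<in>verts G. (y, x) \<in> adj G \<and> \<phi> y < \<phi> x"
  shows "gdist G s x = \<phi> x"
proof -
  have lower: "\<phi> y \<le> m" if "(s, y) \<in> adj G ^^ m" for y m
    using that
  proof (induction m arbitrary: y)
    case (Suc m)
    then obtain z where "(s, z) \<in> adj G ^^ m" "(z, y) \<in> adj G"
      by auto
    with Suc.IH lip show ?case
      by fastforce
  qed (use \<open>\<phi> s = 0\<close> in simp)
  have upper: "\<exists>m\<le>\<phi> y. (s, y) \<in> adj G ^^ m" if "y \<in> verts G" for y
    using that
  proof (induction "\<phi> y" arbitrary: y rule: less_induct)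
    case less
    show ?case
    proof (cases "y = s")
      case True
      then show ?thesis by (intro exI[of _ 0]) auto
    next
      case False
      with down less.prems obtain z where z: "z \<in> verts G" "(z, y) \<in> adj G" "\<phi> z < \<phi> y"
        by blast
      with less.hyps obtain m where "m \<le> \<phi> z" "(s, z) \<in> adj G ^^ m"
        by blast
      with z show ?thesis
        by (intro exI[of _ "Suc m"]) auto
    qed
  qed
  from upper[OF \<open>x \<in> verts G\<close>] lower have "(s, x) \<in> adj G ^^ \<phi> x"
    using order_antisym by metis
  then show ?thesis
    unfolding gdist_def using lower by (intro Least_equality)
qed

definition linked :: "nat \<Rightarrow> nat \<Rightarrow> nat \<Rightarrow> nat \<Rightarrow> bool" where
  "linked n k i j \<longleftrightarrow> i < n \<and> j < n \<and> (j = (i + k) mod n \<or> i = (j + k) mod n)"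

lemma mod_less_if_less: "l mod n < n" if "m < n" for l m n :: nat
  using that by (cases n) auto

lemma pair_in_edges_gen_petersen:
  "{x, y} \<in> edges (gen_petersen n k) \<longleftrightarrow>
     (\<exists>j<n. {x, y} = {U j, U ((j + 1) mod n)} \<or> {x, y} = {V j, V ((j + k) mod n)} \<or> {x, y} = {U j, V j})"
  by (auto simp: gen_petersen_def)

lemma adj_gen_petersen [simp]:
  "(U i, U j) \<in> adj (gen_petersen n k) \<longleftrightarrow> linked n 1 i j"
  "(V i, V j) \<in> adj (gen_petersen n k) \<longleftrightarrow> linked n k i j"
  "(U i, V j) \<in> adj (gen_petersen n k) \<longleftrightarrow> i = j \<and> i < n"
  "(V i, U j) \<in> adj (gen_petersen n k) \<longleftrightarrow> i = j \<and> i < n"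
  unfolding adj_def linked_def mem_Collect_eq case_prod_conv pair_in_edges_gen_petersen doubleton_eq_iff
  using mod_less_if_less by blast+

text \<open>The cases record whether the step passes over column \<open>i\<close> and whether it
  crosses the seam between columns \<open>n - 1\<close> and 0: neither in the first two, only column
  \<open>i\<close> in the third, only the seam in the fourth, both in the last two.\<close>

lemma linked_arc:
  assumes "linked n k i' j'" "i < n" "k < n"
  obtains "arc i j' = arc i i' + k" | "arc i i' = arc i j' + k"
    | "arc i i' + arc i j' = k" | "arc i i' + arc i j' + k = n"
    | "arc i i' + n = arc i j' + k" | "arc i j' + n = arc i i' + k"
proof -
  have "j' = i' + k \<or> j' + n = i' + k \<or> i' = j' + k \<or> i' + n = j' + k" "i' < n" "j' < n"
    using assms by (auto simp: linked_def mod_if split: if_splits)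
  moreover have "i' = i + arc i i' \<or> i = i' + arc i i'" "j' = i + arc i j' \<or> i = j' + arc i j'"
    by (auto simp: arc_def)
  ultimately show thesis
    using assms(2,3)
    by (elim disjE) ((rule that(1), linarith) | (rule that(2), linarith) | (rule that(3), linarith)
        | (rule that(4), linarith) | (rule that(5), linarith) | (rule that(6), linarith))+
qed

lemma arc_less: "i < n \<Longrightarrow> j < n \<Longrightarrow> arc i j < n"
  by (auto simp: arc_def)

text \<open>A step usually changes both arc lengths by \<open>k\<close>, which \<open>step\<close>
  handles. If it passes over column \<open>i\<close>, \<open>small\<close> compares the short arcs
  on the two sides of \<open>i\<close>, and \<open>far\<close> says that the long way round is no
  better.\<close>

lemma cyc_lipschitz:
  assumes "linked n k a b" "i < n" "2 * k < n"
    and step: "\<And>m. f (m + k) \<le> f m + 1" "\<And>m. f m \<le> f (m + k) + 1"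
    and small: "\<And>a b. a + b = k \<Longrightarrow> f a \<le> f b + 1"
    and far: "\<And>a b. a \<le> k \<Longrightarrow> n - k \<le> b \<Longrightarrow> f a \<le> f b"
  shows "cyc f n i b \<le> cyc f n i a + 1"
proof -
  define c d where "c = arc i a" and "d = arc i b"
  have "c < n" "d < n"
    using assms by (auto simp: c_def d_def linked_def arc_less)
  have "k < n"
    using assms(3) by simp
  from linked_arc[OF assms(1,2) this, folded c_def d_def]
  have "min (f d) (f (n - d)) \<le> min (f c) (f (n - c)) + 1"
  proof cases
    assume d: "d = c + k"
    then have "n - c = (n - d) + k" using \<open>d < n\<close> by simp
    with d step[of c] step[of "n - d"] have "f d \<le> f c + 1" "f (n - d) \<le> f (n - c) + 1"
      by simp_all
    then show ?thesis by linarith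
  next
    assume c: "c = d + k"
    then have "n - d = (n - c) + k" using \<open>c < n\<close> by simp
    with c step[of d] step[of "n - c"] have "f d \<le> f c + 1" "f (n - d) \<le> f (n - c) + 1"
      by simp_all
    then show ?thesis by linarith
  next
    assume "c + d = k"
    then have "f d \<le> f c + 1" "f d \<le> f (n - c)"
      using small[of d c] far[of d "n - c"] by simp_all
    then show ?thesis by linarith
  next
    assume "c + d + k = n"
    then have "n - d = c + k" "n - c = d + k"
      by auto
    with step[of c] step[of d] have "f (n - d) \<le> f c + 1" "f d \<le> f (n - c) + 1"
      by simp_all
    then show ?thesis by linarith
  next
    assume "c + n = d + k"
    then have "f (n - d) \<le> f c + 1" "f (n - d) \<le> f (n - c)"
      using \<open>c < n\<close> \<open>d < n\<close> small[of "n - d" c] far[of "n - d" "n - c"] far[of c d] by simp_all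
    then show ?thesis by linarith
  next
    assume "d + n = c + k"
    then have "f d \<le> f c" "f d \<le> f (n - c) + 1"
      using \<open>c < n\<close> \<open>d < n\<close> small[of d "n - c"] far[of d c] by simp_all
    then show ?thesis by linarith
  qed
  then show ?thesis by (simp add: cyc_def c_def d_def)
qed

lemma cyc_le_Suc:
  assumes "\<And>m. f m \<le> g m + 1"
  shows "cyc f n i j \<le> cyc g n i j + 1"
  using assms[of "arc i j"] assms[of "n - arc i j"] unfolding cyc_def by linarith

lemma nat_mod3_cases:
  fixes m :: nat
  obtains (0) a where "m = 3 * a" | (1) a where "m = 3 * a + 1" | (2) a where "m = 3 * a + 2"
proof -
  have "m = 3 * (m div 3) + m mod 3" "m mod 3 = 0 \<or> m mod 3 = 1 \<or> m mod 3 = 2"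
    by auto
  then show ?thesis
    using that by (metis add_0_right)
qed

lemma mod3_sums:
  fixes a :: nat
  shows "(3 * a + 1) div 3 = a" "(3 * a + 2) div 3 = a" "(3 * a + 1) mod 3 = 1" "(3 * a + 2) mod 3 = 2"
    "3 * a + 1 + 1 = 3 * a + 2" "3 * a + 2 + 1 = 3 * (a + 1)" "3 * a + 3 = 3 * (a + 1)"
    "3 * a + 1 + 3 = 3 * (a + 1) + 1" "3 * a + 2 + 3 = 3 * (a + 1) + 2"
  by presburger+

lemma offset_dist_simps:
  "dUU (3 * a) = (if a = 0 then 0 else a + 2)"
  "dUU (3 * a + 1) = (if a = 0 then 1 else a + 3)"
  "dUU (3 * a + 2) = (if a = 0 then 2 else a + 4)"
  "dUV (3 * a) = a + 1" "dUV (3 * a + 1) = a + 2" "dUV (3 * a + 2) = a + 3"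
  "dVV (3 * a) = a" "dVV (3 * a + 1) = a + 3" "dVV (3 * a + 2) = a + 4"
  unfolding offset_dist_defs mod3_sums by auto

text \<open>The bound for \<open>dUU\<close> is due to the spokes: below offset 3 a path of outer
  edges does without them, so the step from 0 to 3 costs 3.\<close>

lemma offset_dist_shift:
  "dUU (m + 1) \<le> dUU m + 1" "dUU m \<le> dUU (m + 1) + 1"
  "dUV (m + 1) \<le> dUV m + 1" "dUV m \<le> dUV (m + 1) + 1"
  "dUV (m + 3) = dUV m + 1" "dVV (m + 3) = dVV m + 1" "3 \<le> m \<Longrightarrow> dUU (m + 3) = dUU m + 1"
  by (cases m rule: nat_mod3_cases; simp only: mod3_sums offset_dist_simps; simp)+

lemma offset_dist_spoke:
  "dUU m \<le> dUV m + 1" "dUV m \<le> dUU m + 1" "dUV m \<le> dVV m + 1" "dVV m \<le> dUV m + 1"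
  by (cases m rule: nat_mod3_cases; simp only: offset_dist_simps; simp)+

lemma offset_dist_ge: "m \<le> 3 * dUU m" "m \<le> 3 * dUV m" "m \<le> 3 * dVV m"
  by (cases m rule: nat_mod3_cases; simp only: offset_dist_simps; simp)+

lemma pdist_lipschitz:
  assumes "13 \<le> n" "s \<in> verts (gen_petersen n 3)" "(x, y) \<in> adj (gen_petersen n 3)"
  shows "pdist n s y \<le> pdist n s x + 1"
proof -
  have less: "i < n" if "s = U i \<or> s = V i" for i
    using assms(2) that by (auto simp: gen_petersen_def)
  have small1: "a = 0 \<and> b = 1 \<or> a = 1 \<and> b = 0" if "a + b = 1" for a b :: nat
    using that by auto
  have small3: "a = 0 \<and> b = 3 \<or> a = 1 \<and> b = 2 \<or> a = 2 \<and> b = 1 \<or> a = 3 \<and> b = 0"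
    if "a + b = 3" for a b :: nat
    using that by arith
  have le1: "a = 0 \<or> a = 1" if "a \<le> 1" for a :: nat
    using that by auto
  have le3: "a = 0 \<or> a = 1 \<or> a = 2 \<or> a = 3" if "a \<le> 3" for a :: nat
    using that by auto
  have small_values: "dUU 0 = 0" "dUU (Suc 0) = 1" "dUV 0 = 1" "dUV (Suc 0) = 2" "dUV 2 = 3" "dUV 3 = 2"
    "dVV 0 = 0" "dVV (Suc 0) = 3" "dVV 2 = 4" "dVV 3 = 1"
    by (simp_all add: offset_dist_defs)
  have far: "dUU a \<le> dUU b" "dUV a \<le> dUV b" if "a \<le> 1" "n - 1 \<le> b" for a b
  proof -
    have "12 \<le> b" using that \<open>13 \<le> n\<close> by simp
    then have "2 \<le> dUU b" "2 \<le> dUV b"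
      using offset_dist_ge[of b] by linarith+
    then show "dUU a \<le> dUU b" and "dUV a \<le> dUV b"
      using le1[OF that(1)] by (auto simp: small_values)
  qed
  have far3: "dUV a \<le> dUV b" "dVV a \<le> dVV b" if "a \<le> 3" "n - 3 \<le> b" for a b
  proof -
    \<comment> \<open>Offset 10 is the least for which \<open>offset_dist_ge\<close> yields 4, and 4
      is the largest value of \<open>dUV\<close> and \<open>dVV\<close> at offsets up to 3. The
      assumption \<open>13 \<le> n\<close> provides it.\<close>
    have "10 \<le> b" using that \<open>13 \<le> n\<close> by simp
    then have "4 \<le> dUV b" "4 \<le> dVV b"
      using offset_dist_ge[of b] by linarith+
    then show "dUV a \<le> dUV b" "dVV a \<le> dVV b"
      using le3[OF that(1)] by (auto simp: small_values)
  qed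
  note intros = far far3 small1 small3 offset_dist_shift(1-6) \<open>13 \<le> n\<close>
  have UU: "cyc dUU n i b \<le> cyc dUU n i a + 1" if "linked n 1 a b" "i < n" for a b i
    by (rule cyc_lipschitz[OF that]) (use intros in \<open>fastforce simp: small_values\<close>)+
  have UV: "cyc dUV n i b \<le> cyc dUV n i a + 1" if "linked n 1 a b" "i < n" for a b i
    by (rule cyc_lipschitz[OF that]) (use intros in \<open>fastforce simp: small_values\<close>)+
  have UV3: "cyc dUV n i b \<le> cyc dUV n i a + 1" if "linked n 3 a b" "i < n" for a b i
    by (rule cyc_lipschitz[OF that]) (use intros in \<open>fastforce simp: small_values\<close>)+
  have VV: "cyc dVV n i b \<le> cyc dVV n i a + 1" if "linked n 3 a b" "i < n" for a b i
    by (rule cyc_lipschitz[OF that]) (use intros in \<open>fastforce simp: small_values\<close>)+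
  have spokes: "cyc dUU n i j \<le> cyc dUV n i j + 1" "cyc dUV n i j \<le> cyc dUU n i j + 1"
    "cyc dUV n i j \<le> cyc dVV n i j + 1" "cyc dVV n i j \<le> cyc dUV n i j + 1" for i j
    by (rule cyc_le_Suc, rule offset_dist_spoke)+
  show ?thesis
    using assms(3) less UU UV UV3 VV spokes
    by (cases s; cases x; cases y; simp; force)
qed

lemma linked_toward:
  assumes "i < n" "j < n" "c = arc i j \<or> c = n - arc i j" "k \<le> c"
  obtains j' where "linked n k j' j" "c - k = arc i j' \<or> c - k = n - arc i j'"
proof -
  consider "i \<le> j" "c = j - i" | "j \<le> i" "c = i - j" | "i \<le> j" "c = n - (j - i)" | "j < i" "c = n - (i - j)"
    using assms by (auto simp: arc_def split: if_splits)
  then show ?thesis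
  proof cases
    case 1
    with assms show ?thesis
      by (intro that[of "j - k"]) (auto simp: linked_def arc_def)
  next
    case 2
    with assms show ?thesis
      by (intro that[of "j + k"]) (auto simp: linked_def arc_def)
  next
    case 3
    show ?thesis
    proof (cases "j + k < n")
      case True
      with 3 assms show ?thesis
        by (intro that[of "j + k"]) (auto simp: linked_def arc_def)
    next
      case False
      with 3 assms show ?thesis
        by (intro that[of "j + k - n"]) (auto simp: linked_def arc_def mod_if)
    qed
  next
    case 4
    show ?thesis
    proof (cases "k \<le> j")
      case True
      with 4 assms show ?thesis
        by (intro that[of "j - k"]) (auto simp: linked_def arc_def)
    next
      case False
      with 4 assms show ?thesis
        by (intro that[of "n + j - k"]) (auto simp: linked_def arc_def)
    qed
  qed
qed

text \<open>Take the arc that attains the minimum and strip the last edge of a shortest path along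
  it. From \<open>U\<close> to \<open>U\<close> this is a spoke for offset at least 3, else an outer
  edge; from \<open>U\<close> to \<open>V\<close> an inner edge for offset at least 3, else a spoke;
  from \<open>V\<close> to \<open>U\<close> a spoke for a multiple of 3, else an outer edge; from
  \<open>V\<close> to \<open>V\<close> an inner edge for a multiple of 3, else a spoke.\<close>

lemma pdist_descent:
  assumes "13 \<le> n" "s \<in> verts (gen_petersen n 3)" "x \<in> verts (gen_petersen n 3)" "x \<noteq> s"
  shows "\<exists>y\<in>verts (gen_petersen n 3). (y, x) \<in> adj (gen_petersen n 3) \<and> pdist n s y < pdist n s x"
proof -
  have verts: "U j \<in> verts (gen_petersen n 3) \<longleftrightarrow> j < n" "V j \<in> verts (gen_petersen n 3) \<longleftrightarrow> j < n" for j
    by (auto simp: gen_petersen_def)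
  have spoke: "cyc f n i j \<le> f c" if "c = arc i j \<or> c = n - arc i j" for f c i j
    using that by (auto simp: cyc_def)
  have outer: "\<exists>j'<n. linked n 1 j' j \<and> cyc f n i j' \<le> f (c - 1)"
    and inner: "3 \<le> c \<Longrightarrow> \<exists>j'<n. linked n 3 j' j \<and> cyc f n i j' \<le> f (c - 3)"
    if "c = arc i j \<or> c = n - arc i j" "1 \<le> c" "i < n" "j < n" for f c i j
    using linked_toward[OF that(3,4,1)] that(2) spoke unfolding linked_def by (metis One_nat_def)+
  have attain: "\<exists>c. (c = arc i j \<or> c = n - arc i j) \<and> cyc f n i j = f c" for f i j
    by (auto simp: cyc_def min_def)
  have UU: "dUV c < dUU c" if "3 \<le> c" for c
    using that by (cases c rule: nat_mod3_cases; simp only: offset_dist_simps; simp)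
  have UUstep: "dUU (c - 1) < dUU c" if "1 \<le> c" "c \<le> 2" for c
    using that by (simp add: dUU_def)
  have UVinner: "dUV (c - 3) < dUV c" if "3 \<le> c" for c
    using offset_dist_shift(5)[of "c - 3"] that by simp
  have UVspoke: "dUU c < dUV c" if "c \<le> 2" for c
    using that by (auto simp: offset_dist_defs)
  have UVouter: "dUV (c - 1) < dUV c" if "c mod 3 \<noteq> 0" for c
    using that by (cases c rule: nat_mod3_cases) (simp_all only: offset_dist_simps, auto simp: offset_dist_defs)
  have UVspoke0: "dVV c < dUV c" if "c mod 3 = 0" for c
    using that by (auto simp: offset_dist_defs)
  have VVinner: "dVV (c - 3) < dVV c" if "3 \<le> c" for c
    using offset_dist_shift(6)[of "c - 3"] that by simp
  have VVspoke: "dUV c < dVV c" if "c mod 3 \<noteq> 0" for c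
    using that by (auto simp: offset_dist_defs)
  have c0: "c \<noteq> 0" if "c = arc i j \<or> c = n - arc i j" "i < n" "j < n" "i \<noteq> j" for c i j
    using that by (auto simp: arc_def split: if_splits)
  show ?thesis
  proof (cases s; cases x)
    fix i j assume [simp]: "s = U i" "x = U j"
    then have ij: "i < n" "j < n" "i \<noteq> j" using assms by (auto simp: verts)
    obtain c where c: "c = arc i j \<or> c = n - arc i j" "cyc dUU n i j = dUU c"
      using attain by blast
    show ?thesis
    proof (cases "3 \<le> c")
      case True
      with c UU spoke[OF c(1), of dUV] ij have "pdist n s (V j) < pdist n s x" by fastforce
      then show ?thesis using ij by (intro bexI[of _ "V j"]) (auto simp: verts)
    next
      case False
      with c0[OF c(1) ij] outer[OF c(1) _ ij(1,2), of dUU] obtain j' where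
        "j' < n" "linked n 1 j' j" "cyc dUU n i j' \<le> dUU (c - 1)" by auto
      with False c0[OF c(1) ij] UUstep[of c] c(2) show ?thesis
        by (intro bexI[of _ "U j'"]) (auto simp: verts)
    qed
  next
    fix i j assume [simp]: "s = U i" "x = V j"
    then have ij: "i < n" "j < n" using assms by (auto simp: verts)
    obtain c where c: "c = arc i j \<or> c = n - arc i j" "cyc dUV n i j = dUV c"
      using attain by blast
    show ?thesis
    proof (cases "3 \<le> c")
      case True
      with inner[OF c(1) _ ij True, of dUV] obtain j' where
        "j' < n" "linked n 3 j' j" "cyc dUV n i j' \<le> dUV (c - 3)" by auto
      with True UVinner[of c] c(2) show ?thesis
        by (intro bexI[of _ "V j'"]) (auto simp: verts)
    next
      case False
      with c UVspoke[of c] spoke[OF c(1), of dUU] have "pdist n s (U j) < pdist n s x" by simp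
      then show ?thesis using ij by (intro bexI[of _ "U j"]) (auto simp: verts)
    qed
  next
    fix i j assume [simp]: "s = V i" "x = U j"
    then have ij: "i < n" "j < n" using assms by (auto simp: verts)
    obtain c where c: "c = arc i j \<or> c = n - arc i j" "cyc dUV n i j = dUV c"
      using attain by blast
    show ?thesis
    proof (cases "c mod 3 = 0")
      case True
      with c UVspoke0[of c] spoke[OF c(1), of dVV] have "pdist n s (V j) < pdist n s x" by simp
      then show ?thesis using ij by (intro bexI[of _ "V j"]) (auto simp: verts)
    next
      case False
      then have "1 \<le> c" by (cases c) auto
      with outer[OF c(1) _ ij, of dUV] obtain j' where
        "j' < n" "linked n 1 j' j" "cyc dUV n i j' \<le> dUV (c - 1)" by auto
      with UVouter[OF False] c(2) show ?thesis
        by (intro bexI[of _ "U j'"]) (auto simp: verts)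
    qed
  next
    fix i j assume [simp]: "s = V i" "x = V j"
    then have ij: "i < n" "j < n" "i \<noteq> j" using assms by (auto simp: verts)
    obtain c where c: "c = arc i j \<or> c = n - arc i j" "cyc dVV n i j = dVV c"
      using attain by blast
    show ?thesis
    proof (cases "c mod 3 = 0")
      case True
      with c0[OF c(1) ij] have "3 \<le> c" by auto
      with inner[OF c(1) _ ij(1,2), of dVV] obtain j' where
        "j' < n" "linked n 3 j' j" "cyc dVV n i j' \<le> dVV (c - 3)" by auto
      with \<open>3 \<le> c\<close> VVinner[of c] c(2) show ?thesis
        by (intro bexI[of _ "V j'"]) (auto simp: verts)
    next
      case False
      with c VVspoke[of c] spoke[OF c(1), of dUV] have "pdist n s (U j) < pdist n s x" by simp
      then show ?thesis using ij by (intro bexI[of _ "U j"]) (auto simp: verts)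
    qed
  qed
qed

theorem gdist_gen_petersen_3:
  assumes "13 \<le> n" "s \<in> verts (gen_petersen n 3)" "x \<in> verts (gen_petersen n 3)"
  shows "gdist (gen_petersen n 3) s x = pdist n s x"
proof (rule gdist_eqI[OF assms(2,3)])
  show "pdist n s s = 0"
    by (cases s) (simp_all add: cyc_def arc_def offset_dist_defs)
qed (use assms pdist_lipschitz pdist_descent in blast)+

section \<open>Contraction of P(n, 3) to P(n - 6, 3): distances\<close>

fun col :: "pvertex \<Rightarrow> nat" where
  "col (U j) = j"
| "col (V j) = j"

fun move :: "(nat \<Rightarrow> nat) \<Rightarrow> pvertex \<Rightarrow> pvertex" where
  "move g (U j) = U (g j)"
| "move g (V j) = V (g j)"

fun profile :: "pvertex \<Rightarrow> pvertex \<Rightarrow> nat \<Rightarrow> nat" where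
  "profile (U _) (U _) = dUU"
| "profile (V _) (V _) = dVV"
| "profile _ _ = dUV"

lemma pdist_eq_cyc: "pdist n x y = cyc (profile x y) n (col x) (col y)"
  by (cases x; cases y) auto

lemma profile_move [simp]: "profile (move g x) y = profile x y" "profile x (move g y) = profile x y"
  by (cases x; cases y; simp)+

lemma col_move [simp]: "col (move g x) = g (col x)"
  by (cases x) auto

text \<open>The functions are not monotone, and 8 is the least gap that works for all of them:
  \<open>dVV 2 = 4\<close>, but \<open>dVV 9 = 3\<close>.\<close>

lemma offset_dist_mono:
  assumes "m + 8 \<le> m'"
  shows "dUU m \<le> dUU m'" "dUV m \<le> dUV m'" "dVV m \<le> dVV m'"
  by (insert assms, cases m rule: nat_mod3_cases; cases m' rule: nat_mod3_cases; simp only: offset_dist_simps; auto)+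

lemma profile_shift: "3 \<le> m \<Longrightarrow> profile x y (m + 3) = profile x y m + 1"
  by (cases x; cases y) (simp_all add: offset_dist_shift)

lemma profile_mono: "m + 8 \<le> m' \<Longrightarrow> profile x y m \<le> profile x y m'"
  by (cases x; cases y) (simp_all add: offset_dist_mono)

text \<open>All six deleted columns lie on one arc, which even afterwards exceeds the other by at
  least 8. By \<open>profile_mono\<close> the other arc realises the distance in both graphs. Hence
  14 = 6 + 8.\<close>

lemma pdist_contract_same:
  assumes "profile s' x' = profile s x"
    and "arc (col s') (col x') = arc (col s) (col x) \<and> 2 * arc (col s) (col x) + 14 \<le> n \<or>
         arc (col s') (col x') + 6 = arc (col s) (col x) \<and> n + 14 \<le> 2 * arc (col s) (col x) \<and>
         arc (col s) (col x) \<le> n"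
  shows "pdist n s x = pdist (n - 6) s' x'"
  using assms(2)
proof (elim disjE conjE)
  assume a: "arc (col s') (col x') = arc (col s) (col x)" "2 * arc (col s) (col x) + 14 \<le> n"
  then have "profile s x (arc (col s) (col x)) \<le> profile s x (n - arc (col s) (col x))"
    "profile s x (arc (col s) (col x)) \<le> profile s x (n - 6 - arc (col s) (col x))"
    by (auto intro!: profile_mono)
  then show ?thesis
    using a assms(1) by (simp add: pdist_eq_cyc cyc_def)
next
  assume a: "arc (col s') (col x') + 6 = arc (col s) (col x)" "n + 14 \<le> 2 * arc (col s) (col x)"
    "arc (col s) (col x) \<le> n"
  then have eq: "n - 6 - arc (col s') (col x') = n - arc (col s) (col x)"
    by simp
  have "profile s x (n - arc (col s) (col x)) \<le> profile s x (arc (col s) (col x))"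
    "profile s x (n - arc (col s) (col x)) \<le> profile s x (arc (col s') (col x'))"
    using a by (auto intro!: profile_mono)
  then show ?thesis
    using assms(1) unfolding pdist_eq_cyc cyc_def eq by simp
qed

text \<open>Both arcs lose three columns and keep length at least 3, so both values drop by exactly
  1, and so does their minimum.\<close>

lemma pdist_contract_less:
  assumes "profile s' x' = profile s x"
    and "arc (col s) (col x) = arc (col s') (col x') + 3"
    and "3 \<le> arc (col s') (col x')" "arc (col s) (col x) + 6 \<le> n"
  shows "pdist n s x = pdist (n - 6) s' x' + 1"
proof -
  have "n - arc (col s) (col x) = n - 6 - arc (col s') (col x') + 3"
    using assms by simp
  moreover have "profile s x (arc (col s') (col x') + 3) = profile s x (arc (col s') (col x')) + 1"
    "profile s x (n - 6 - arc (col s') (col x') + 3) = profile s x (n - 6 - arc (col s') (col x')) + 1"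
    using assms by (intro profile_shift; simp)+
  ultimately show ?thesis
    using assms(1,2) by (simp add: pdist_eq_cyc cyc_def)
qed

text \<open>The margin is 9 = 7 + 2: \<open>pdist_contract_same\<close> asks for an arc of length at
  most n/2 - 7, and the low landmarks reach up to column 2. The condition \<open>col x < n\<close>
  guards against truncated subtraction.\<close>

definition near :: "nat \<Rightarrow> pvertex \<Rightarrow> bool" where
  "near n x \<longleftrightarrow> col x + 9 \<le> n div 2 \<or> n - col x + 9 \<le> n div 2 \<and> col x < n"

text \<open>The margin is 10 = 7 + 3: again an arc of length at most n/2 - 7 is needed, now to a
  landmark up to 3 columns away from n/2.\<close>

definition far :: "nat \<Rightarrow> pvertex \<Rightarrow> bool" where
  "far n x \<longleftrightarrow> 10 \<le> col x \<and> col x + 10 \<le> n"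

text \<open>Renumbering of the columns below and above the deleted ones.\<close>

definition fold_near :: "nat \<Rightarrow> nat \<Rightarrow> nat" where
  "fold_near n j = (if j \<le> n div 2 then j else j - 6)"

definition fold_far :: "nat \<Rightarrow> nat" where
  "fold_far j = j - 3"

lemma near_fold_near:
  assumes "near n x"
  shows "col x + 9 \<le> n div 2 \<and> fold_near n (col x) = col x \<or>
    n - col x + 9 \<le> n div 2 \<and> col x < n \<and> n div 2 < col x \<and> fold_near n (col x) = col x - 6"
  using assms by (auto simp: near_def fold_near_def)

lemma pdist_near_low:
  assumes "48 \<le> n" "near n x" "col s \<le> 2"
  shows "pdist n s x = pdist (n - 6) s (move (fold_near n) x)"
proof (rule pdist_contract_same)
  define h where "h = n div 2"
  have h: "2 * h \<le> n" "24 \<le> h"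
    using assms(1) by (auto simp: h_def)
  from near_fold_near[OF assms(2), folded h_def]
  show "arc (col s) (col (move (fold_near n) x)) = arc (col s) (col x) \<and> 2 * arc (col s) (col x) + 14 \<le> n \<or>
         arc (col s) (col (move (fold_near n) x)) + 6 = arc (col s) (col x) \<and> n + 14 \<le> 2 * arc (col s) (col x) \<and>
         arc (col s) (col x) \<le> n"
    using h assms(3) unfolding arc_def col_move by (elim disjE conjE) auto
qed simp

text \<open>The deleted columns separate \<open>x\<close> from \<open>s\<close> on both arcs, three
  on each.\<close>

lemma pdist_near_mid:
  assumes "48 \<le> n" "near n x" "n \<le> 2 * col s + 6" "2 * col s \<le> n + 6"
  shows "pdist n s x = pdist (n - 6) (move fold_far s) (move (fold_near n) x) + 1"
proof -
  define h where "h = n div 2"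
  have h: "2 * h \<le> n" "24 \<le> h"
    using assms(1) by (auto simp: h_def)
  note s = assms(3,4)
  have "arc (col s) (col x) = arc (fold_far (col s)) (fold_near n (col x)) + 3 \<and>
    3 \<le> arc (fold_far (col s)) (fold_near n (col x)) \<and> arc (col s) (col x) + 6 \<le> n"
    using near_fold_near[OF assms(2), folded h_def] h s
    unfolding arc_def fold_far_def by (elim disjE conjE) auto
  then show ?thesis
    by (intro pdist_contract_less) auto
qed

lemma pdist_far_low:
  assumes "48 \<le> n" "far n x" "col s \<le> 2"
  shows "pdist n s x = pdist (n - 6) s (move fold_far x) + 1"
  using assms
  by (intro pdist_contract_less) (auto simp: far_def fold_far_def arc_def)

lemma pdist_far_mid:
  assumes "48 \<le> n" "far n x" "n \<le> 2 * col s + 6" "2 * col s \<le> n + 6"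
  shows "pdist n s x = pdist (n - 6) (move fold_far s) (move fold_far x)"
proof (intro pdist_contract_same disjI1 conjI)
  show "2 * arc (col s) (col x) + 14 \<le> n"
    using assms unfolding far_def arc_def by auto
  show "arc (col (move fold_far s)) (col (move fold_far x)) = arc (col s) (col x)"
    using assms by (auto simp: far_def fold_far_def arc_def)
qed simp

section \<open>Contraction of P(n, 3) to P(n - 6, 3): edges\<close>

lemma linked_iff:
  assumes "k < n"
  shows "linked n k i j \<longleftrightarrow>
    i < n \<and> j < n \<and> (j = i + k \<or> j + n = i + k \<or> i = j + k \<or> i + n = j + k)"
proof -
  have mod_iff: "b = (a + k) mod n \<longleftrightarrow> b = a + k \<or> b + n = a + k" if "a < n" "b < n" for a b
    using assms that by (cases "a + k < n") (auto simp: mod_if)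
  show ?thesis
    unfolding linked_def using mod_iff[of i j] mod_iff[of j i] by blast
qed

text \<open>The gap at the top is wider than \<open>k\<close>, so a step stays on one side of it,
  where the renumbering is a translation, or crosses the seam at column 0, where the upper column
  and \<open>n\<close> both drop by 6.\<close>

lemma linked_near:
  assumes "48 \<le> n" "linked n k i j" "k \<le> 3"
    and "i + 9 \<le> n div 2 \<or> n - i + 9 \<le> n div 2" "j + 9 \<le> n div 2 \<or> n - j + 9 \<le> n div 2"
  shows "linked (n - 6) k (fold_near n i) (fold_near n j)"
proof -
  define h where "h = n div 2"
  have h: "2 * h \<le> n" "24 \<le> h"
    using assms(1) by (auto simp: h_def)
  have ij: "i < n" "j < n" and adj: "j = i + k \<or> j + n = i + k \<or> i = j + k \<or> i + n = j + k"
    using assms linked_iff[of k n i j] by auto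
  have fold: "i + 9 \<le> h \<and> fold_near n i = i \<or> h < i \<and> n + 9 \<le> h + i \<and> fold_near n i + 6 = i"
    "j + 9 \<le> h \<and> fold_near n j = j \<or> h < j \<and> n + 9 \<le> h + j \<and> fold_near n j + 6 = j"
    using assms(4,5) ij h unfolding fold_near_def h_def[symmetric] by auto
  obtain m where m: "n = m + 6" "n - 6 = m"
    using assms(1) by (intro that[of "n - 6"]) auto
  have "fold_near n i < m" "fold_near n j < m"
    using fold ij h m by (elim disjE conjE; linarith)+
  moreover have "fold_near n j = fold_near n i + k \<or> fold_near n j + m = fold_near n i + k \<or>
     fold_near n i = fold_near n j + k \<or> fold_near n i + m = fold_near n j + k"
    using adj
  proof (elim disjE)
    assume "j = i + k"
    then have "fold_near n j = fold_near n i + k"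
      using fold ij h assms(3) by (elim disjE conjE; linarith)
    then show ?thesis by simp
  next
    assume "j + n = i + k"
    then have "fold_near n j + m = fold_near n i + k"
      using fold ij h m assms(3) by (elim disjE conjE; linarith)
    then show ?thesis by simp
  next
    assume "i = j + k"
    then have "fold_near n i = fold_near n j + k"
      using fold ij h assms(3) by (elim disjE conjE; linarith)
    then show ?thesis by simp
  next
    assume "i + n = j + k"
    then have "fold_near n i + m = fold_near n j + k"
      using fold ij h m assms(3) by (elim disjE conjE; linarith)
    then show ?thesis by simp
  qed
  ultimately show ?thesis
    using m h assms(3) by (subst linked_iff) auto
qed

lemma linked_far:
  assumes "48 \<le> n" "linked n k i j" "k \<le> 3" "9 \<le> i" "i + 9 \<le> n" "9 \<le> j" "j + 9 \<le> n"
  shows "linked (n - 6) k (fold_far i) (fold_far j)"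
  using assms linked_iff[of k n i j] linked_iff[of k "n - 6" "i - 3" "j - 3"]
  unfolding fold_far_def by auto

lemma adj_near:
  assumes "48 \<le> n" "(x, y) \<in> adj (gen_petersen n 3)" "near n x" "near n y"
  shows "(move (fold_near n) x, move (fold_near n) y) \<in> adj (gen_petersen (n - 6) 3)"
  using assms
  by (cases x; cases y) (auto simp: near_def intro!: linked_near, auto simp: fold_near_def)

lemma adj_far:
  assumes "48 \<le> n" "(x, y) \<in> adj (gen_petersen n 3)" "far n x" "far n y"
  shows "(move fold_far x, move fold_far y) \<in> adj (gen_petersen (n - 6) 3)"
  using assms
  by (cases x; cases y) (auto simp: far_def intro!: linked_far, auto simp: fold_far_def)

lemma inj_near: "inj_on (move (fold_near n)) {x. near n x}"
proof (rule inj_onI)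
  fix x y
  assume "x \<in> {x. near n x}" "y \<in> {x. near n x}" "move (fold_near n) x = move (fold_near n) y"
  then show "x = y"
    by (cases x; cases y) (auto simp: near_def fold_near_def split: if_splits)
qed

lemma inj_far: "inj_on (move fold_far) {x. far n x}"
proof (rule inj_onI)
  fix x y
  assume "x \<in> {x. far n x}" "y \<in> {x. far n x}" "move fold_far x = move fold_far y"
  then show "x = y"
    by (cases x; cases y) (auto simp: far_def fold_far_def)
qed

lemma verts_gen_petersen: "x \<in> verts (gen_petersen n k) \<longleftrightarrow> col x < n"
  by (cases x) (auto simp: gen_petersen_def)

lemma edges_gen_petersenE:
  assumes "e \<in> edges (gen_petersen n k)"
  obtains x y where "e = {x, y}" "(x, y) \<in> adj (gen_petersen n k)" "col x < n" "col y < n"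
proof -
  have "\<exists>x y. e = {x, y} \<and> col x < n \<and> col y < n"
    using assms unfolding gen_petersen_def by fastforce
  then show thesis
    using that assms unfolding adj_def by blast
qed

lemma edge_dist_gen_petersen_3:
  assumes "13 \<le> n" "col s < n" "col x < n" "col y < n"
  shows "edge_dist (gen_petersen n 3) s {x, y} = min (pdist n s x) (pdist n s y)"
  using assms by (simp add: edge_dist_pair gdist_gen_petersen_3 verts_gen_petersen)

text \<open>A constant added to the distances of both ends passes through the minimum. The ends of
  the image are vertices of the smaller graph because the image is an edge, and 19 = 13 + 6 admits
  the distance formula there.\<close>

lemma edge_dist_image:
  assumes "19 \<le> n" "e \<in> edges (gen_petersen n 3)" "g ` e \<in> edges (gen_petersen (n - 6) 3)"
    and "col s < n" "col s' < n - 6" "\<And>z. z \<in> e \<Longrightarrow> pdist n s z = pdist (n - 6) s' (g z) + c"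
  shows "edge_dist (gen_petersen n 3) s e = edge_dist (gen_petersen (n - 6) 3) s' (g ` e) + c"
proof -
  obtain x y where e: "e = {x, y}" "col x < n" "col y < n"
    using assms(2) by (rule edges_gen_petersenE)
  have "col z < n - 6" if "z \<in> g ` e" for z
    using assms(3) by (rule edges_gen_petersenE) (use that in auto)
  then have "col (g x) < n - 6" "col (g y) < n - 6"
    by (simp_all add: e(1))
  then have "edge_dist (gen_petersen (n - 6) 3) s' (g ` e) = min (pdist (n - 6) s' (g x)) (pdist (n - 6) s' (g y))"
    using edge_dist_gen_petersen_3[of "n - 6" s' "g x" "g y"] assms(1,5) by (simp add: e(1))
  moreover have "edge_dist (gen_petersen n 3) s e = min (pdist n s x) (pdist n s y)"
    using edge_dist_gen_petersen_3[of n s x y] assms(1,4) e by simp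
  ultimately show ?thesis
    using assms(6)[of x] assms(6)[of y] by (simp add: e(1) min_add_distrib_left)
qed

lemma image_near_edge:
  assumes "48 \<le> n" "e \<in> edges (gen_petersen n 3)" "\<And>z. z \<in> e \<Longrightarrow> near n z"
  shows "move (fold_near n) ` e \<in> edges (gen_petersen (n - 6) 3)"
  using assms(2)
proof (rule edges_gen_petersenE)
  fix x y
  assume "e = {x, y}" "(x, y) \<in> adj (gen_petersen n 3)"
  with assms adj_near[of n x y] show ?thesis
    by (auto simp: adj_def)
qed

lemma image_far_edge:
  assumes "48 \<le> n" "e \<in> edges (gen_petersen n 3)" "\<And>z. z \<in> e \<Longrightarrow> far n z"
  shows "move fold_far ` e \<in> edges (gen_petersen (n - 6) 3)"
  using assms(2)
proof (rule edges_gen_petersenE)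
  fix x y
  assume "e = {x, y}" "(x, y) \<in> adj (gen_petersen n 3)"
  with assms adj_far[of n x y] show ?thesis
    by (auto simp: adj_def)
qed

section \<open>Heights of edges from their distance to \<open>U 0\<close>\<close>

text \<open>Up to offset 9 the only value of \<open>dUU\<close> and \<open>dUV\<close> above 5 is
  \<open>dUU 8 = 6\<close>. For an outer vertex at height 8 the other end helps: it is an inner
  vertex at height 8 or an outer one at height 7 or 9, all at distance at most 5.\<close>

lemma edge_dist_le_5_if_not_far:
  assumes "48 \<le> n" "e \<in> edges (gen_petersen n 3)" "x \<in> e" "\<not> far n x"
  shows "edge_dist (gen_petersen n 3) (U 0) e \<le> 5"
proof -
  obtain y where e: "e = {x, y}" "(x, y) \<in> adj (gen_petersen n 3)" "col x < n" "col y < n"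
    using assms(2,3) sym_adj[of "gen_petersen n 3", THEN symD] 
    by (elim edges_gen_petersenE) blast
  have dUV: "dUV m \<le> 5" if "m \<le> 9" for m
    using that by (cases m rule: nat_mod3_cases; simp only: offset_dist_simps; simp)
  have dUU: "dUU m \<le> 5" if "m \<le> 9" "m \<noteq> 8" for m
    using that by (cases m rule: nat_mod3_cases; simp only: offset_dist_simps; simp)
  have short: "pdist n (U 0) z \<le> profile (U 0) z m" if "m = col z \<or> m = n - col z" for z m
    using that by (auto simp: pdist_eq_cyc cyc_def arc_def)
  obtain m where m: "m = col x \<or> m = n - col x" "m \<le> 9"
    using assms(4) e(3) unfolding far_def by force
  have "pdist n (U 0) x \<le> 5 \<or> pdist n (U 0) y \<le> 5"
  proof (cases x)
    case (V j)
    with short[OF m(1)] dUV[OF m(2)] show ?thesis by simp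
  next
    case (U j)
    show ?thesis
    proof (cases "m = 8")
      case False
      with short[OF m(1)] dUU[OF m(2)] U show ?thesis by simp
    next
      case True
      show ?thesis
      proof (cases y)
        case (V j')
        with e U m short[of m y] dUV[OF m(2)] show ?thesis by auto
      next
        case (U j')
        with e \<open>x = U j\<close> \<open>48 \<le> n\<close> have "linked n 1 j j'" by simp
        then have "j' = j + 1 \<or> j' + n = j + 1 \<or> j = j' + 1 \<or> j + n = j' + 1"
          using \<open>48 \<le> n\<close> by (simp add: linked_iff)
        with m True \<open>48 \<le> n\<close> e(3,4) U \<open>x = U j\<close> obtain l where "l = j' \<or> l = n - j'" "l = 7 \<or> l = 9"
          by (elim disjE) fastforce+
        with short[of l y] dUU[of l] U show ?thesis by fastforce
      qed
    qed
  qed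
  then show ?thesis
    using e assms(1) by (simp add: edge_dist_gen_petersen_3 min_le_iff_disj)
qed

text \<open>From offset 13 on, \<open>dUU\<close> and \<open>dUV\<close> are at least 6. The other
  end of the edge may be 3 lower, so height 16 is needed; a vertex that is not near has height at
  least \<open>n div 2 - 8\<close>, which is 16 at \<open>n = 48\<close>.\<close>

lemma edge_dist_ge_6_if_not_near:
  assumes "48 \<le> n" "e \<in> edges (gen_petersen n 3)" "x \<in> e" "\<not> near n x"
  shows "6 \<le> edge_dist (gen_petersen n 3) (U 0) e"
proof -
  obtain y where e: "e = {x, y}" "(x, y) \<in> adj (gen_petersen n 3)" "col x < n" "col y < n"
    using assms(2,3) sym_adj[of "gen_petersen n 3", THEN symD] 
    by (elim edges_gen_petersenE) blast
  have "6 \<le> dUV m" "6 \<le> dUU m" if "13 \<le> m" for m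
    using that by (cases m rule: nat_mod3_cases; simp only: offset_dist_simps; simp)+
  then have "6 \<le> pdist n (U 0) z" if "13 \<le> col z" "col z + 13 \<le> n" for z
    using that by (cases z) (simp_all add: cyc_def arc_def)
  moreover have x: "16 \<le> col x" "col x + 16 \<le> n"
    using assms(1,4) e(3) by (auto simp: near_def)
  moreover have "13 \<le> col y" "col y + 13 \<le> n"
    using e(2) x \<open>48 \<le> n\<close> by (cases x; cases y; auto simp: linked_iff)+
  ultimately show ?thesis
    using e assms(1) by (simp add: edge_dist_gen_petersen_3)
qed

text \<open>The two bounds meet: an edge at distance at most 5 has only near ends, any other edge
  only far ends.\<close>

lemma all_near_or_all_far:
  assumes "48 \<le> n" "e \<in> edges (gen_petersen n 3)" "e' \<in> edges (gen_petersen n 3)"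
    and "edge_dist (gen_petersen n 3) (U 0) e = edge_dist (gen_petersen n 3) (U 0) e'"
  shows "(\<forall>x\<in>e \<union> e'. near n x) \<or> (\<forall>x\<in>e \<union> e'. far n x)"
proof (cases "edge_dist (gen_petersen n 3) (U 0) e \<le> 5")
  case True
  with assms edge_dist_ge_6_if_not_near[of n e] edge_dist_ge_6_if_not_near[of n e'] show ?thesis
    by fastforce
next
  case False
  with assms edge_dist_le_5_if_not_far[of n e] edge_dist_le_5_if_not_far[of n e'] show ?thesis
    by fastforce
qed

section \<open>Resolving sets under the contraction\<close>

theorem edge_resolving_set_step:
  assumes "48 \<le> n"
    and low: "U 0 \<in> L" "\<And>s. s \<in> L \<Longrightarrow> col s \<le> 2"
    and mid: "\<And>s. s \<in> M \<Longrightarrow> n \<le> 2 * col s + 6 \<and> 2 * col s \<le> n + 6"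
    and res: "edge_resolving_set (gen_petersen (n - 6) 3) (L \<union> move fold_far ` M)"
  shows "edge_resolving_set (gen_petersen n 3) (L \<union> M)"
proof -
  note distinguished = res[unfolded edge_resolving_set_def, THEN conjunct2, rule_format]
  \<comment> \<open>Stated for an arbitrary renumbering \<open>g\<close>, so that it serves near and
    far edges alike; \<open>c\<close> and \<open>d\<close> are the losses in distance from the low
    and the middle landmarks.\<close>
  have unique: "g ` e = g ` e'"
    if e: "e \<in> edges (gen_petersen n 3)" "g ` e \<in> edges (gen_petersen (n - 6) 3)"
      and e': "e' \<in> edges (gen_petersen n 3)" "g ` e' \<in> edges (gen_petersen (n - 6) 3)"
      and eq: "\<And>s. s \<in> L \<union> M \<Longrightarrow> edge_dist (gen_petersen n 3) s e = edge_dist (gen_petersen n 3) s e'"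
      and L: "\<And>s z. s \<in> L \<Longrightarrow> z \<in> e \<union> e' \<Longrightarrow> pdist n s z = pdist (n - 6) s (g z) + c"
      and M: "\<And>s z. s \<in> M \<Longrightarrow> z \<in> e \<union> e' \<Longrightarrow> pdist n s z = pdist (n - 6) (move fold_far s) (g z) + d"
    for g e e' c d
  proof (rule ccontr)
    assume "g ` e \<noteq> g ` e'"
    with distinguished[OF e(2) e'(2)] obtain s' where s': "s' \<in> L \<union> move fold_far ` M"
      "edge_dist (gen_petersen (n - 6) 3) s' (g ` e) \<noteq> edge_dist (gen_petersen (n - 6) 3) s' (g ` e')"
      by blast
    then consider "s' \<in> L" | s where "s \<in> M" "s' = move fold_far s"
      by blast
    then show False
    proof cases
      case 1
      with low(2)[of s'] \<open>48 \<le> n\<close> have "col s' < n" "col s' < n - 6"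
        by simp_all
      with 1 s' eq[of s'] e e' L \<open>48 \<le> n\<close> edge_dist_image[of n e g s' s' c] edge_dist_image[of n e' g s' s' c]
      show False by simp
    next
      case 2
      with mid[of s] \<open>48 \<le> n\<close> have "col s < n" "col s' < n - 6"
        by (auto simp: fold_far_def)
      with 2 s' eq[of s] e e' M \<open>48 \<le> n\<close> edge_dist_image[of n e g s s' d] edge_dist_image[of n e' g s s' d]
      show False by simp
    qed
  qed
  show ?thesis
    unfolding edge_resolving_set_def
  proof (intro conjI ballI impI)
    show "L \<union> M \<subseteq> verts (gen_petersen n 3)"
      using low(2) mid \<open>48 \<le> n\<close> by (fastforce simp: verts_gen_petersen)
  next
    fix e e'
    assume e: "e \<in> edges (gen_petersen n 3)" "e' \<in> edges (gen_petersen n 3)" "e \<noteq> e'"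
    show "\<exists>s\<in>L \<union> M. edge_dist (gen_petersen n 3) s e \<noteq> edge_dist (gen_petersen n 3) s e'"
    proof (rule ccontr)
      assume "\<not> ?thesis"
      then have eq: "edge_dist (gen_petersen n 3) s e = edge_dist (gen_petersen n 3) s e'" if "s \<in> L \<union> M" for s
        using that by blast
      with low(1) all_near_or_all_far[OF \<open>48 \<le> n\<close> e(1,2)]
      consider "\<And>z. z \<in> e \<union> e' \<Longrightarrow> near n z" | "\<And>z. z \<in> e \<union> e' \<Longrightarrow> far n z"
        by blast
      then show False
      proof cases
        case 1
        have "move (fold_near n) ` e = move (fold_near n) ` e'"
        \<comment> \<open>Near edges are on the same side of the deleted columns as \<open>L\<close>
          and on the other side from \<open>M\<close>; for far edges the roles are
          exchanged.\<close>
        proof (rule unique[where c = 0 and d = 1])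
          show "pdist n s z = pdist (n - 6) s (move (fold_near n) z) + 0" if "s \<in> L" "z \<in> e \<union> e'" for s z
            using that 1 low(2) pdist_near_low[OF \<open>48 \<le> n\<close>] by simp
          show "pdist n s z = pdist (n - 6) (move fold_far s) (move (fold_near n) z) + 1"
            if "s \<in> M" "z \<in> e \<union> e'" for s z
            using that 1 mid pdist_near_mid[OF \<open>48 \<le> n\<close>] by simp
        qed (use 1 e eq \<open>48 \<le> n\<close> in \<open>auto intro!: image_near_edge\<close>)
        with inj_near[of n] 1 e(3) show False
          by (subst (asm) inj_on_image_eq_iff) auto
      next
        case 2
        have "move fold_far ` e = move fold_far ` e'"
        proof (rule unique[where c = 1 and d = 0])
          show "pdist n s z = pdist (n - 6) s (move fold_far z) + 1" if "s \<in> L" "z \<in> e \<union> e'" for s z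
            using that 2 low(2) pdist_far_low[OF \<open>48 \<le> n\<close>] by simp
          show "pdist n s z = pdist (n - 6) (move fold_far s) (move fold_far z) + 0"
            if "s \<in> M" "z \<in> e \<union> e'" for s z
            using that 2 mid pdist_far_mid[OF \<open>48 \<le> n\<close>] by simp
        qed (use 2 e eq \<open>48 \<le> n\<close> in \<open>auto intro!: image_far_edge\<close>)
        with inj_far[of n] 2 e(3) show False
          by (subst (asm) inj_on_image_eq_iff) auto
      qed
    qed
  qed
qed

section \<open>Edge codes and their computation\<close>

definition edge_list :: "nat \<Rightarrow> (pvertex \<times> pvertex) list" where
  "edge_list n = map (\<lambda>j. (U j, U ((j + 1) mod n))) [0..<n] @
     map (\<lambda>j. (V j, V ((j + 3) mod n))) [0..<n] @ map (\<lambda>j. (U j, V j)) [0..<n]"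

definition edge_row :: "nat \<Rightarrow> pvertex \<Rightarrow> nat list" where
  "edge_row n s = map (\<lambda>(x, y). min (pdist n s x) (pdist n s y)) (edge_list n)"

text \<open>Transposes the rows, one per landmark, into codes, one per edge. The argument
  \<open>m\<close> is the number of edges, which an empty list of rows does not reveal.\<close>

fun codes :: "nat \<Rightarrow> nat list list \<Rightarrow> nat list list" where
  "codes m [] = replicate m []"
| "codes m (r # rs) = map2 (#) r (codes m rs)"

lemma set_edge_list: "edges (gen_petersen n 3) = (\<lambda>(x, y). {x, y}) ` set (edge_list n)"
proof -
  have "(\<Union>j<n. {a j, b j, c j}) = a ` {..<n} \<union> (b ` {..<n} \<union> c ` {..<n})" for a b c :: "nat \<Rightarrow> pvertex set"
    by auto
  then show ?thesis
    by (simp add: gen_petersen_def edge_list_def image_Un image_image atLeast0LessThan)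
qed

lemma codes_map: "codes (length xs) (map (\<lambda>s. map (f s) xs) R) = map (\<lambda>e. map (\<lambda>s. f s e) R) xs"
  by (induction R) (auto simp: map_replicate_const zip_map1 zip_map2 zip_same_conv_map)

lemma edge_resolving_setI:
  assumes "13 \<le> n" "\<And>s. s \<in> set R \<Longrightarrow> col s < n"
    and "distinct (codes (3 * n) (map (edge_row n) R))"
  shows "edge_resolving_set (gen_petersen n 3) (set R)"
  unfolding edge_resolving_set_def
proof (intro conjI ballI impI)
  show "set R \<subseteq> verts (gen_petersen n 3)"
    using assms(2) by (auto simp: verts_gen_petersen)
next
  fix e e'
  assume e: "e \<in> edges (gen_petersen n 3)" "e' \<in> edges (gen_petersen n 3)" "e \<noteq> e'"
  define \<delta> where "\<delta> s = (\<lambda>(x, y). min (pdist n s x) (pdist n s y))" for s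
  have "length (edge_list n) = 3 * n"
    by (simp add: edge_list_def)
  then have "codes (3 * n) (map (edge_row n) R) = map (\<lambda>e. map (\<lambda>s. \<delta> s e) R) (edge_list n)"
    using codes_map[of "edge_list n" \<delta> R] by (simp add: edge_row_def[abs_def] \<delta>_def)
  with assms(3) have inj: "inj_on (\<lambda>e. map (\<lambda>s. \<delta> s e) R) (set (edge_list n))"
    by (simp add: distinct_map)
  obtain p p' where p: "p \<in> set (edge_list n)" "e = (\<lambda>(x, y). {x, y}) p"
    "p' \<in> set (edge_list n)" "e' = (\<lambda>(x, y). {x, y}) p'"
    using e(1,2) unfolding set_edge_list by blast
  with e(3) have "p \<noteq> p'" by auto
  with inj p have "map (\<lambda>s. \<delta> s p) R \<noteq> map (\<lambda>s. \<delta> s p') R"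
    by (metis inj_onD)
  then have "\<exists>s\<in>set R. \<delta> s p \<noteq> \<delta> s p'"
    by (simp add: map_eq_conv)
  then obtain s where s: "s \<in> set R" "\<delta> s p \<noteq> \<delta> s p'"
    by blast
  have "edge_dist (gen_petersen n 3) s (case q of (x, y) \<Rightarrow> {x, y}) = \<delta> s q" if "q \<in> set (edge_list n)" for q
  proof -
    have "case q of (x, y) \<Rightarrow> col x < n \<and> col y < n"
      using that mod_less_divisor[of n] assms(1)
      unfolding edge_list_def set_append set_map set_upt by (elim UnE imageE; simp)
    with assms(1) assms(2)[OF s(1)] show ?thesis
      by (auto simp: \<delta>_def edge_dist_gen_petersen_3 split: prod.splits)
  qed
  with p s show "\<exists>s\<in>set R. edge_dist (gen_petersen n 3) s e \<noteq> edge_dist (gen_petersen n 3) s e'"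
    by metis
qed

text \<open>
  All rows are rotations of three tables, which are passed as arguments so that they are evaluated
  only once for each \<open>n\<close>.
\<close>

definition spin :: "nat \<Rightarrow> 'a list \<Rightarrow> 'a list" where
  "spin k xs = drop k xs @ take k xs"

text \<open>If \<open>t\<close> lists the values of \<open>f\<close> at 0 to \<open>n\<close>,
  reversal pairs each offset with its complement, which gives \<open>cyc f n 0\<close>. The dropped
  entry, for offset \<open>n\<close>, would repeat column 0.\<close>

definition arc_table :: "nat list \<Rightarrow> nat list" where
  "arc_table t = butlast (map2 min t (rev t))"

text \<open>Rotation by 1 and by 3 aligns the two ends of outer and of inner edges; the three blocks
  follow the order of \<open>edge_list\<close>.\<close>

definition join_rows :: "nat list \<Rightarrow> nat list \<Rightarrow> nat list" where
  "join_rows us vs = map2 min us (spin 1 us) @ map2 min vs (spin 3 vs) @ map2 min us vs"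

fun source_row :: "nat \<Rightarrow> nat list \<Rightarrow> nat list \<Rightarrow> nat list \<Rightarrow> pvertex \<Rightarrow> nat list" where
  "source_row n tUU tUV tVV (U i) = join_rows (spin (n - i) tUU) (spin (n - i) tUV)"
| "source_row n tUU tUV tVV (V i) = join_rows (spin (n - i) tUV) (spin (n - i) tVV)"

lemma spin_map_upt:
  assumes "k < n"
  shows "spin k (map f [0..<n]) = map (\<lambda>j. f ((j + k) mod n)) [0..<n]"
  using assms
  by (intro nth_equalityI) (auto simp: spin_def nth_append mod_if add.commute)

lemma spin_arc_table:
  assumes "i < n"
  shows "spin (n - i) (arc_table (map f [0..<Suc n])) = map (cyc f n i) [0..<n]"
proof -
  have "arc_table (map f [0..<Suc n]) = map (cyc f n 0) [0..<n]"
    by (intro nth_equalityI)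
      (auto simp: arc_table_def nth_butlast rev_nth cyc_def arc_def simp del: upt_Suc)
  moreover have "spin (n - i) (map (cyc f n 0) [0..<n]) = map (cyc f n i) [0..<n]"
  \<comment> \<open>For \<open>i = 0\<close> the rotation is by \<open>n\<close>, outside the scope
    of \<open>spin_map_upt\<close>, but it is the identity.\<close>
  proof (cases "i = 0")
    case True
    then show ?thesis by (simp add: spin_def)
  next
    case False
    have "cyc f n 0 ((j + (n - i)) mod n) = cyc f n i j" if "j < n" for j
      using that assms False
      by (cases "i \<le> j") (auto simp: cyc_def arc_def mod_if min.commute add.commute)
    with False assms show ?thesis
      by (auto simp: spin_map_upt)
  qed
  ultimately show ?thesis by simp
qed

lemma edge_row_code:
  assumes "3 < n" "col s < n"
  shows "edge_row n s = source_row n (arc_table (map dUU [0..<Suc n]))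
     (arc_table (map dUV [0..<Suc n])) (arc_table (map dVV [0..<Suc n])) s"
  using assms
  by (cases s) (simp_all add: edge_row_def edge_list_def join_rows_def spin_arc_table spin_map_upt
      zip_map1 zip_map2 zip_same_conv_map del: upt_Suc)

text \<open>Grouping the codes by their first entry avoids most of the quadratically many comparisons.\<close>

definition distinct_buckets :: "'a list list \<Rightarrow> bool" where
  "distinct_buckets xss \<longleftrightarrow>
     list_all (\<lambda>c. distinct (filter (\<lambda>xs. hd xs = c) xss)) (remdups (map hd xss))"

lemma distinct_if_distinct_buckets:
  assumes "distinct_buckets xss"
  shows "distinct xss"
proof -
  have "i = j" if ij: "i < length xss" "j < length xss" "xss ! i = xss ! j" "i < j" for i j
  proof -
    define c where "c = hd (xss ! i)"
    have "distinct (filter (\<lambda>xs. hd xs = c) xss)"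
      using assms ij(1) by (auto simp: distinct_buckets_def list_all_iff c_def)
    moreover have "xss = take j xss @ xss ! j # drop (Suc j) xss"
      using ij(2) by (rule id_take_nth_drop)
    ultimately have "distinct (filter (\<lambda>xs. hd xs = c) (take j xss @ xss ! j # drop (Suc j) xss))"
      by simp
    then have "xss ! j \<notin> set (take j xss)"
      using ij(3) by (auto simp: c_def)
    with ij show ?thesis
      by (auto simp: in_set_conv_nth)
  qed
  then show ?thesis
    unfolding distinct_conv_nth by (metis linorder_neqE_nat)
qed

section \<open>The landmarks of the theorem\<close>

definition landmarks :: "nat \<Rightarrow> pvertex list" where
  "landmarks n =
     (if n mod 6 = 2 then [U 0, U 1, U (n div 2 - 3), V (n div 2 - 2)]
      else if n mod 6 = 4 then [U 0, U 1, V 2, U (n div 2 + 3)]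
      else if n mod 6 = 5 then [U 0, U 1, U (n div 2 - 1), V (n div 2)]
      else [U 0, U 1, V 2, U (n div 2 - 1)])"

definition landmarks_check :: "nat \<Rightarrow> bool" where
  "landmarks_check n \<longleftrightarrow> distinct_buckets (codes (3 * n) (map (source_row n (arc_table (map dUU [0..<Suc n]))
     (arc_table (map dUV [0..<Suc n])) (arc_table (map dVV [0..<Suc n]))) (landmarks n)))"

lemma col_landmarks: "19 \<le> n \<Longrightarrow> s \<in> set (landmarks n) \<Longrightarrow> col s < n"
  by (auto simp: landmarks_def split: if_splits)

lemma landmarks_resolve_if_landmarks_check:
  assumes "19 \<le> n" "landmarks_check n"
  shows "edge_resolving_set (gen_petersen n 3) (set (landmarks n))"
proof (rule edge_resolving_setI)
  have "map (edge_row n) (landmarks n) = map (source_row n (arc_table (map dUU [0..<Suc n]))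
     (arc_table (map dUV [0..<Suc n])) (arc_table (map dVV [0..<Suc n]))) (landmarks n)"
    using assms(1) edge_row_code[of n] col_landmarks[of n] by simp
  with assms(2) show "distinct (codes (3 * n) (map (edge_row n) (landmarks n)))"
    by (simp only: landmarks_check_def distinct_if_distinct_buckets)
qed (use assms(1) col_landmarks[of n] in auto)

lemma small_landmarks_check: "list_all landmarks_check [19..<48]"
  by code_simp

lemma landmarks_resolve:
  assumes "19 \<le> n"
  shows "edge_resolving_set (gen_petersen n 3) (set (landmarks n))"
  using assms
proof (induction n rule: less_induct)
  case (less n)
  show ?case
  proof (cases "n < 48")
    case True
    with less.prems small_landmarks_check have "landmarks_check n"
      by (simp add: list_all_iff del: upt_rec_numeral)
    with less.prems show ?thesis
      by (rule landmarks_resolve_if_landmarks_check)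
  next
    case False
    then have n: "48 \<le> n" by simp
    \<comment> \<open>\<open>L\<close> collects the landmarks in fixed columns and \<open>M\<close>
      those in columns relative to \<open>n div 2\<close>. Passing to \<open>n - 6\<close> keeps the
      residue and lowers \<open>n div 2\<close> by 3, which is the effect of \<open>fold_far\<close>
      on \<open>M\<close>.\<close>
    define L where "L = (if n mod 6 \<in> {2, 5} then {U 0, U 1} else {U 0, U 1, V 2})"
    define M where "M = (if n mod 6 = 2 then {U (n div 2 - 3), V (n div 2 - 2)}
      else if n mod 6 = 4 then {U (n div 2 + 3)}
      else if n mod 6 = 5 then {U (n div 2 - 1), V (n div 2)} else {U (n div 2 - 1)})"
    have mod: "(n - 6) mod 6 = n mod 6" and div: "(n - 6) div 2 = n div 2 - 3"
      using n by (auto simp: mod_if[of n])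
    have h: "24 \<le> n div 2"
      using n by simp
    have "set (landmarks n) = L \<union> M"
      by (auto simp: landmarks_def L_def M_def)
    moreover have "set (landmarks (n - 6)) = L \<union> move fold_far ` M"
      using h by (auto simp: landmarks_def L_def M_def mod div fold_far_def)
    moreover have "edge_resolving_set (gen_petersen (n - 6) 3) (set (landmarks (n - 6)))"
      using n by (intro less.IH) auto
    moreover have "n \<le> 2 * col s + 6 \<and> 2 * col s \<le> n + 6" if "s \<in> M" for s
    \<comment> \<open>The columns \<open>n div 2 - 3\<close> and \<open>n div 2 + 3\<close> occur
      for even \<open>n\<close> only, where they meet the two bounds with equality.\<close>
    proof (cases "even n")
      case True
      with that n show ?thesis by (auto simp: M_def split: if_splits)
    next
      case False
      then have "n mod 6 \<noteq> 2" "n mod 6 \<noteq> 4"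
        by presburger+
      with that n show ?thesis by (auto simp: M_def split: if_splits)
    qed
    moreover have "U 0 \<in> L" "\<And>s. s \<in> L \<Longrightarrow> col s \<le> 2"
      by (auto simp: L_def split: if_splits)
    ultimately show ?thesis
      using edge_resolving_set_step[OF n] by simp
  qed
qed

theorem mainTheorem2:
  fixes n :: nat
  assumes "n \<ge> 19"
  shows "(n mod 6 \<in> {0, 1, 3} \<longrightarrow>
            edge_resolving_set (gen_petersen n 3) {U 0, U 1, V 2, U (n div 2 - 1)}) \<and>
         (n mod 6 = 2 \<longrightarrow>
            edge_resolving_set (gen_petersen n 3) {U 0, U 1, U (n div 2 - 3), V (n div 2 - 2)}) \<and>
         (n mod 6 = 4 \<longrightarrow>
            edge_resolving_set (gen_petersen n 3) {U 0, U 1, V 2, U (n div 2 + 3)}) \<and>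
         (n mod 6 = 5 \<longrightarrow>
            edge_resolving_set (gen_petersen n 3) {U 0, U 1, U (n div 2 - 1), V (n div 2)})"
  using landmarks_resolve[OF assms] by (auto simp: landmarks_def)

end
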